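(* Let $k$ be a positive integer. For any $2k$-connected line graph $L(G)$ and any $S \subsetneq V(L(G))$ with $|S| \leq k$, the graph $L(G)-S$ has $k$ completely independent spanning trees if $G$ is not super edge-connected or $\delta(G) \geq 2k$.
   Context: All graphs are finite, simple and undirected. $L(G)$ is the line graph of $G$ (vertex set $E(G)$, two vertices adjacent iff the corresponding edges share an endpoint). $\delta(G)$ is the minimum degree of $G$. A graph is $k$-connected if its (vertex) connectivity is at least $k$. An edge-cut of a connected graph is a set of edges whose removal disconnects it; a connected graph is super edge-connected if every minimum edge-cut isolates a vertex. Spanning trees $T_1,\dots,T_k$ of a graph $H$ are completely independent if for any two distinct vertices $u,v$ of $H$, the $u$–$v$ paths in $T_1,\dots,T_k$ are pairwise edge-disjoint and pairwise share no vertex other than $u$ and $v$. *)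

theory Defs
  imports Main
begin

record 'a ugraph =
  verts :: "'a set"
  edges :: "'a set set"

definition simple_graph :: "'a ugraph \<Rightarrow> bool" where
  "simple_graph G \<longleftrightarrow> finite (verts G) \<and> (\<forall>e\<in>edges G. e \<subseteq> verts G \<and> card e = 2)"

definition degree :: "'a ugraph \<Rightarrow> 'a \<Rightarrow> nat" where
  "degree G v = card {e \<in> edges G. v \<in> e}"

text \<open>Only meaningful for finite graphs with at least one vertex.\<close>
definition min_degree :: "'a ugraph \<Rightarrow> nat" where
  "min_degree G = Min (degree G ` verts G)"

text \<open>Walks and paths are given by their nonempty lists of vertices.\<close>

fun walk_edges :: "'a list \<Rightarrow> 'a set set" where
  "walk_edges [] = {}"
| "walk_edges [x] = {}"
| "walk_edges (x # y # xs) = insert {x, y} (walk_edges (y # xs))"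

definition is_walk :: "'a ugraph \<Rightarrow> 'a list \<Rightarrow> bool" where
  "is_walk G p \<longleftrightarrow> p \<noteq> [] \<and> set p \<subseteq> verts G \<and> walk_edges p \<subseteq> edges G"

definition is_path :: "'a ugraph \<Rightarrow> 'a \<Rightarrow> 'a list \<Rightarrow> 'a \<Rightarrow> bool" where
  "is_path G u p v \<longleftrightarrow> is_walk G p \<and> distinct p \<and> hd p = u \<and> last p = v"

definition is_cycle :: "'a ugraph \<Rightarrow> 'a list \<Rightarrow> bool" where
  "is_cycle G p \<longleftrightarrow>
     is_walk G p \<and> distinct p \<and> 3 \<le> length p \<and> {last p, hd p} \<in> edges G"

text \<open>The graph without vertices does not count as connected.\<close>
definition graph_connected :: "'a ugraph \<Rightarrow> bool" where
  "graph_connected G \<longleftrightarrow>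
     verts G \<noteq> {} \<and> (\<forall>u\<in>verts G. \<forall>v\<in>verts G. \<exists>p. is_path G u p v)"

definition delete_verts :: "'a ugraph \<Rightarrow> 'a set \<Rightarrow> 'a ugraph" where
  "delete_verts G S = \<lparr>verts = verts G - S, edges = {e \<in> edges G. e \<inter> S = {}}\<rparr>"

definition delete_edges :: "'a ugraph \<Rightarrow> 'a set set \<Rightarrow> 'a ugraph" where
  "delete_edges G F = \<lparr>verts = verts G, edges = edges G - F\<rparr>"

text \<open>The least number of vertices whose deletion leaves a disconnected graph or at most
  one vertex; thus the complete graph on \<open>n \<ge> 1\<close> vertices has connectivity \<open>n - 1\<close>.\<close>
definition vertex_connectivity :: "'a ugraph \<Rightarrow> nat" where
  "vertex_connectivity G =
     (LEAST n. \<exists>S\<subseteq>verts G. card S = n \<and>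
        (\<not> graph_connected (delete_verts G S) \<or> card (verts G - S) \<le> 1))"

definition k_connected :: "nat \<Rightarrow> 'a ugraph \<Rightarrow> bool" where
  "k_connected k G \<longleftrightarrow> k \<le> vertex_connectivity G"

definition is_edge_cut :: "'a ugraph \<Rightarrow> 'a set set \<Rightarrow> bool" where
  "is_edge_cut G F \<longleftrightarrow> F \<subseteq> edges G \<and> \<not> graph_connected (delete_edges G F)"

definition is_minimum_edge_cut :: "'a ugraph \<Rightarrow> 'a set set \<Rightarrow> bool" where
  "is_minimum_edge_cut G F \<longleftrightarrow>
     is_edge_cut G F \<and> (\<forall>F'. is_edge_cut G F' \<longrightarrow> card F \<le> card F')"

definition isolates_vertex :: "'a ugraph \<Rightarrow> 'a set set \<Rightarrow> bool" where
  "isolates_vertex G F \<longleftrightarrow> (\<exists>v\<in>verts G. \<forall>e\<in>edges (delete_edges G F). v \<notin> e)"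

text \<open>Super edge-connectivity is a notion for connected graphs only: the negation of the
  following predicate also holds for every disconnected graph.\<close>
definition super_edge_connected :: "'a ugraph \<Rightarrow> bool" where
  "super_edge_connected G \<longleftrightarrow>
     graph_connected G \<and> (\<forall>F. is_minimum_edge_cut G F \<longrightarrow> isolates_vertex G F)"

definition line_graph :: "'a ugraph \<Rightarrow> 'a set ugraph" where
  "line_graph G =
     \<lparr>verts = edges G,
      edges = {{e, f} | e f. e \<in> edges G \<and> f \<in> edges G \<and> e \<noteq> f \<and> e \<inter> f \<noteq> {}}\<rparr>"

definition is_tree :: "'a ugraph \<Rightarrow> bool" where
  "is_tree T \<longleftrightarrow> simple_graph T \<and> graph_connected T \<and> (\<nexists>p. is_cycle T p)"

definition spanning_tree :: "'a ugraph \<Rightarrow> 'a ugraph \<Rightarrow> bool" where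
  "spanning_tree H T \<longleftrightarrow> is_tree T \<and> verts T = verts H \<and> edges T \<subseteq> edges H"

text \<open>The trees are \<open>T 0, \<dots>, T (k - 1)\<close>. Since paths in a tree are unique, quantifying over
  all paths between two vertices speaks about the unique such path.\<close>
definition completely_independent_spanning_trees ::
    "'a ugraph \<Rightarrow> nat \<Rightarrow> (nat \<Rightarrow> 'a ugraph) \<Rightarrow> bool" where
  "completely_independent_spanning_trees H k T \<longleftrightarrow>
     (\<forall>i<k. spanning_tree H (T i)) \<and>
     (\<forall>u\<in>verts H. \<forall>v\<in>verts H. u \<noteq> v \<longrightarrow>
        (\<forall>i<k. \<forall>j<k. i \<noteq> j \<longrightarrow>
           (\<forall>p q. is_path (T i) u p v \<and> is_path (T j) u q v \<longrightarrow>
              walk_edges p \<inter> walk_edges q = {} \<and> set p \<inter> set q \<subseteq> {u, v})))"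

end

theory Submission
  imports Defs "HOL-Library.Disjoint_Sets"
begin

text \<open>Either hypothesis on \<open>G\<close> upgrades the essential \<open>2k\<close>-edge-connectivity given by \<open>L(G)\<close> to
  \<open>2k\<close>-edge-connectivity: an edge cut with an edge on both sides is a vertex cut of \<open>L(G)\<close>. Hence a
  partition of the vertices into \<open>m\<close> parts has at least \<open>k m\<close> crossing edges, of which at least
  \<open>k (m - 1)\<close> survive the deletion of \<open>S\<close>, and by the theorem of Nash-Williams and Tutte \<open>G - S\<close> has
  \<open>k\<close> edge-disjoint spanning trees. Their edge sets, with the remaining edges distributed arbitrarily,
  are the inner vertices of \<open>k\<close> completely independent spanning trees of \<open>L(G) - S = L(G - S)\<close>.\<close>

section \<open>Packing independent sets of a matroid\<close>

text \<open>A matroid is given by its closure operator, with the Mac Lane-Steinitz exchange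
  property. For graphs this operator amounts to reachability, so neither circuits nor ranks have to
  be set up first.\<close>

locale matroid_span =
  fixes sp :: "'e set \<Rightarrow> 'e set"
  assumes sp_mono: "A \<subseteq> B \<Longrightarrow> sp A \<subseteq> sp B"
    and sp_superset: "A \<subseteq> sp A"
    and sp_idem: "sp (sp A) \<subseteq> sp A"
    and sp_exchange: "x \<in> sp (insert y A) \<Longrightarrow> x \<notin> sp A \<Longrightarrow> y \<in> sp (insert x A)"
begin

definition indep :: "'e set \<Rightarrow> bool" where
  "indep A \<longleftrightarrow> (\<forall>a\<in>A. a \<notin> sp (A - {a}))"

lemma sp_least: "A \<subseteq> sp B \<Longrightarrow> sp A \<subseteq> sp B"
  using sp_mono sp_idem by blast

lemma indep_empty: "indep {}"
  by (simp add: indep_def)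

lemma indep_subset:
  assumes "indep A" "B \<subseteq> A"
  shows "indep B"
  unfolding indep_def
proof
  fix b assume "b \<in> B"
  moreover have "sp (B - {b}) \<subseteq> sp (A - {b})"
    using assms(2) by (intro sp_mono) auto
  ultimately show "b \<notin> sp (B - {b})"
    using assms unfolding indep_def by blast
qed

lemma indep_insert:
  assumes "indep A" "x \<notin> sp A"
  shows "indep (insert x A)"
  unfolding indep_def
proof
  fix a assume a: "a \<in> insert x A"
  show "a \<notin> sp (insert x A - {a})"
  proof (cases "a = x")
    case True
    then have "sp (insert x A - {a}) \<subseteq> sp A"
      by (intro sp_mono) auto
    then show ?thesis using assms(2) True by blast
  next
    case False
    then have eq: "insert x A - {a} = insert x (A - {a})" "insert a (A - {a}) = A"
      using a by auto
    show ?thesis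
      using sp_exchange[of a x "A - {a}"] assms a False unfolding eq indep_def by auto
  qed
qed

text \<open>The set on the right is the fundamental circuit of \<open>x\<close> in \<open>A\<close>,
  without \<open>x\<close>. A smallest \<open>D\<close> inside \<open>A\<close> spanning
  \<open>x\<close> is contained in it: if \<open>A - {y}\<close> spanned \<open>x\<close> for some
  \<open>y\<close> in \<open>D\<close>, exchange would put \<open>y\<close> into the span of
  \<open>A - {y}\<close>.\<close>

lemma in_sp_fundamental_circuit:
  assumes "finite A" "indep A" "x \<in> sp A"
  shows "x \<in> sp {y \<in> A. x \<notin> sp (A - {y})}"
proof -
  obtain D where D: "D \<subseteq> A" "x \<in> sp D"
    and least: "\<And>D'. D' \<subseteq> A \<Longrightarrow> x \<in> sp D' \<Longrightarrow> card D \<le> card D'"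
    using ex_has_least_nat[of "\<lambda>D. D \<subseteq> A \<and> x \<in> sp D" A card] assms(3) by blast
  have "D \<subseteq> {y \<in> A. x \<notin> sp (A - {y})}"
  proof (intro subsetI CollectI conjI notI)
    fix y assume y: "y \<in> D"
    then show "y \<in> A" using D by blast
    assume x: "x \<in> sp (A - {y})"
    have "card (D - {y}) < card D"
      using y D(1) assms(1) by (meson card_Diff1_less finite_subset)
    then have "x \<notin> sp (D - {y})"
      using least[of "D - {y}"] D(1) by fastforce
    moreover have "x \<in> sp (insert y (D - {y}))"
      using D(2) y by (simp add: insert_absorb)
    ultimately have "y \<in> sp (insert x (D - {y}))"
      using sp_exchange by blast
    moreover have "insert x (D - {y}) \<subseteq> sp (A - {y})"
      using x D(1) sp_superset[of "A - {y}"] by auto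
    ultimately have "y \<in> sp (A - {y})"
      using sp_least by blast
    then show False
      using \<open>y \<in> A\<close> assms(2) unfolding indep_def by blast
  qed
  then show ?thesis using D(2) sp_mono by blast
qed

definition packing :: "'e set \<Rightarrow> nat \<Rightarrow> (nat \<Rightarrow> 'e set) \<Rightarrow> bool" where
  "packing E k I \<longleftrightarrow> (\<forall>i<k. I i \<subseteq> E \<and> indep (I i)) \<and> disjoint_family_on I {..<k}"

text \<open>When \<open>J i\<close> spans \<open>e\<close>, the last premise of \<open>swap\<close>
  says that \<open>y\<close> lies on the fundamental circuit of \<open>e\<close>. The swap covers
  \<open>e\<close> and uncovers \<open>y\<close>.\<close>

inductive swap_reachable ::
  "'e set \<Rightarrow> nat \<Rightarrow> (nat \<Rightarrow> 'e set) \<Rightarrow> (nat \<Rightarrow> 'e set) \<Rightarrow> bool"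
  for E :: "'e set" and k :: nat and I :: "nat \<Rightarrow> 'e set" where
  refl: "swap_reachable E k I I"
| swap: "\<lbrakk>swap_reachable E k I J; i < k; e \<in> E; e \<notin> (\<Union>l<k. J l); y \<in> J i; e \<notin> sp (J i - {y})\<rbrakk>
    \<Longrightarrow> swap_reachable E k I (J(i := insert e (J i - {y})))"

lemma packing_swap:
  assumes "packing E k J" "i < k" "e \<in> E" "e \<notin> (\<Union>l<k. J l)" "y \<in> J i" "e \<notin> sp (J i - {y})"
  shows "packing E k (J(i := insert e (J i - {y})))"
    and "(\<Union>l<k. (J(i := insert e (J i - {y}))) l) = insert e ((\<Union>l<k. J l) - {y})"
proof -
  have disj: "J l \<inter> J m = {}" if "l < k" "m < k" "l \<noteq> m" for l m
    using assms(1) that unfolding packing_def disjoint_family_on_def by auto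
  have "indep (insert e (J i - {y}))"
    using assms(1,2,6) indep_subset[of "J i" "J i - {y}"]
    by (intro indep_insert) (auto simp: packing_def)
  then show "packing E k (J(i := insert e (J i - {y})))"
    using assms disj unfolding packing_def disjoint_family_on_def by auto blast+
  show "(\<Union>l<k. (J(i := insert e (J i - {y}))) l) = insert e ((\<Union>l<k. J l) - {y})"
    using assms(2,5) disj by (auto split: if_splits)
qed

lemma packing_insert:
  assumes "packing E k J" "i < k" "e \<in> E" "e \<notin> (\<Union>l<k. J l)" "e \<notin> sp (J i)"
  shows "packing E k (J(i := insert e (J i)))"
    and "(\<Union>l<k. (J(i := insert e (J i))) l) = insert e (\<Union>l<k. J l)"
  using assms indep_insert[of "J i" e] unfolding packing_def disjoint_family_on_def
  by (auto split: if_splits)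

text \<open>A swap trades one covered element for another, so everything reached from a maximum
  packing is again a maximum packing.\<close>

lemma swap_reachable_packing:
  assumes "finite E" "packing E k I" "swap_reachable E k I J"
  shows "packing E k J \<and> card (\<Union>l<k. J l) = card (\<Union>l<k. I l)"
  using assms(3)
proof induction
  case refl
  then show ?case using assms(2) by simp
next
  case (swap J i e y)
  have sub: "(\<Union>l<k. J l) \<subseteq> E"
    using swap.IH unfolding packing_def by blast
  then have fin: "finite (\<Union>l<k. J l)"
    using assms(1) by (rule finite_subset)
  have y: "y \<in> (\<Union>l<k. J l)"
    using swap.hyps by blast
  have "card (insert e ((\<Union>l<k. J l) - {y})) = Suc (card ((\<Union>l<k. J l) - {y}))"
    using swap.hyps fin by (intro card_insert_disjoint) auto
  also have "\<dots> = card (\<Union>l<k. J l)"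
    by (rule card_Suc_Diff1[OF fin y])
  finally show ?case
    using packing_swap[of E k J i e y] swap by (simp del: fun_upd_apply)
qed

text \<open>The set \<open>R\<close> collects the elements left uncovered by some packing that arises from a maximum
  packing \<open>I\<close> by swaps. Every circuit used in a swap lies in \<open>R\<close>, so swaps do not change the span of
  the part inside \<open>R\<close>. No shortest augmenting paths are needed.\<close>
theorem packing_tight_set:
  assumes fin: "finite E"
  obtains I R where "packing E k I" "R \<subseteq> E" "E - (\<Union>i<k. I i) \<subseteq> R"
    "\<And>i. i < k \<Longrightarrow> R \<subseteq> sp (I i \<inter> R)"
proof -
  have "packing E k (\<lambda>_. {})"
    by (simp add: packing_def indep_empty disjoint_family_on_def)
  moreover have bound: "card (\<Union>i<k. J i) \<le> card E" if "packing E k J" for J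
    using that fin by (intro card_mono) (auto simp: packing_def)
  ultimately obtain I where I: "packing E k I"
    and max: "\<And>J. packing E k J \<Longrightarrow> card (\<Union>i<k. J i) \<le> card (\<Union>i<k. I i)"
    using ex_has_greatest_nat[of "packing E k" "\<lambda>_. {}" "\<lambda>J. card (\<Union>i<k. J i)" "Suc (card E)"]
    by (metis le_imp_less_Suc)
  define R where "R = {e \<in> E. \<exists>J. swap_reachable E k I J \<and> e \<notin> (\<Union>l<k. J l)}"
  have circuit: "{y \<in> J i. e \<notin> sp (J i - {y})} \<subseteq> R" and in_sp: "e \<in> sp (J i \<inter> R)"
    if J: "swap_reachable E k I J" and i: "i < k" and e: "e \<in> E" "e \<notin> (\<Union>l<k. J l)" for J i e
  proof -
    have pJ: "packing E k J" and cJ: "card (\<Union>l<k. J l) = card (\<Union>l<k. I l)"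
      using swap_reachable_packing[OF fin I J] by auto
    show circ: "{y \<in> J i. e \<notin> sp (J i - {y})} \<subseteq> R"
    proof
      fix y assume "y \<in> {y \<in> J i. e \<notin> sp (J i - {y})}"
      then have y: "y \<in> J i" "e \<notin> sp (J i - {y})" by auto
      have "y \<noteq> e" using y e i by blast
      \<comment> \<open>Swapping \<open>e\<close> in leaves \<open>y\<close> uncovered, and this is
        what membership in \<open>R\<close> asks for.\<close>
      then have "y \<notin> (\<Union>l<k. (J(i := insert e (J i - {y}))) l)"
        unfolding packing_swap(2)[OF pJ i e y] by blast
      moreover have "y \<in> E" using pJ y i unfolding packing_def by blast
      ultimately show "y \<in> R"
        using swap_reachable.swap[OF J i e y] unfolding R_def by blast
    qed
    have fJ: "finite (\<Union>l<k. J l)"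
      using pJ fin unfolding packing_def by (meson UN_least finite_subset lessThan_iff)
    \<comment> \<open>Otherwise \<open>e\<close> could be added to class \<open>i\<close>, and the
      packing would cover more than the maximum.\<close>
    have "e \<in> sp (J i)"
    proof (rule ccontr)
      assume "e \<notin> sp (J i)"
      note ins = packing_insert[OF pJ i e this]
      show False
        using max[OF ins(1)] fJ e(2) unfolding ins(2) cJ[symmetric] by simp
    qed
    moreover have "finite (J i)" "indep (J i)"
      using pJ i fin unfolding packing_def by (auto intro: finite_subset)
    ultimately have "e \<in> sp {y \<in> J i. e \<notin> sp (J i - {y})}"
      by (intro in_sp_fundamental_circuit)
    then show "e \<in> sp (J i \<inter> R)"
      using sp_mono[of "{y \<in> J i. e \<notin> sp (J i - {y})}" "J i \<inter> R"] circ by blast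
  qed
  \<comment> \<open>A swap changes class \<open>i\<close> only, and both \<open>e\<close> and
    \<open>y\<close> lie in \<open>R\<close>. By exchange each of them is spanned by the other
    together with the rest of \<open>J i \<inter> R\<close>.\<close>
  have invariant: "sp (J l \<inter> R) = sp (I l \<inter> R)" if "swap_reachable E k I J" for J l
    using that
  proof induction
    case refl
    then show ?case by simp
  next
    case (swap J i e y)
    show ?case
    proof (cases "l = i")
      case True
      let ?A = "J i \<inter> R"
      have e: "e \<in> sp ?A" and y: "y \<in> ?A" and eR: "e \<in> R"
        using circuit[of J i e] in_sp[of J i e] swap.hyps unfolding R_def by auto
      have "e \<notin> sp (?A - {y})"
        using swap.hyps sp_mono[of "?A - {y}" "J i - {y}"] by blast
      moreover have "insert y (?A - {y}) = ?A" using y by blast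
      ultimately have y': "y \<in> sp (insert e (?A - {y}))"
        using sp_exchange[of e y "?A - {y}"] e by simp
      have "sp (insert e (?A - {y})) = sp ?A"
      proof
        show "sp (insert e (?A - {y})) \<subseteq> sp ?A"
          using e sp_superset[of ?A] by (intro sp_least) auto
        show "sp ?A \<subseteq> sp (insert e (?A - {y}))"
          using y' sp_superset[of "insert e (?A - {y})"] by (intro sp_least) auto
      qed
      moreover have "insert e (J i - {y}) \<inter> R = insert e (?A - {y})"
        using eR by blast
      ultimately show ?thesis using swap.IH True by simp
    qed (use swap.IH in simp)
  qed
  show thesis
  proof
    show "packing E k I" by (rule I)
    show "R \<subseteq> E" by (auto simp: R_def)
    show "E - (\<Union>i<k. I i) \<subseteq> R"
      using swap_reachable.refl unfolding R_def by blast
    show "R \<subseteq> sp (I i \<inter> R)" if "i < k" for i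
      using in_sp[OF _ that] invariant unfolding R_def by blast
  qed
qed

end

section \<open>The tree packing theorem\<close>

text \<open>The relation lives on the whole type and is reflexive there, so it depends on an edge
  set alone, as the matroid arguments require.\<close>

definition conn :: "'a set set \<Rightarrow> 'a rel" where
  "conn F = {(x, y). {x, y} \<in> F}\<^sup>*"

lemma conn_refl [simp]: "(x, x) \<in> conn F"
  by (simp add: conn_def)

lemma conn_edge: "{x, y} \<in> F \<Longrightarrow> (x, y) \<in> conn F"
  by (auto simp: conn_def)

lemma conn_trans: "(x, y) \<in> conn F \<Longrightarrow> (y, z) \<in> conn F \<Longrightarrow> (x, z) \<in> conn F"
  unfolding conn_def by (rule rtrancl_trans)

lemma conn_sym: "(x, y) \<in> conn F \<Longrightarrow> (y, x) \<in> conn F"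
proof -
  have "sym {(x, y). {x, y} \<in> F}"
    by (auto simp: sym_def insert_commute)
  then show "(x, y) \<in> conn F \<Longrightarrow> (y, x) \<in> conn F"
    unfolding conn_def by (meson sym_rtrancl symD)
qed

lemma conn_mono: "F \<subseteq> F' \<Longrightarrow> conn F \<subseteq> conn F'"
  unfolding conn_def by (intro rtrancl_mono) auto

lemma conn_induct [consumes 1, case_names refl step]:
  assumes "(x, y) \<in> conn F" "P x"
    and "\<And>y z. (x, y) \<in> conn F \<Longrightarrow> {y, z} \<in> F \<Longrightarrow> P y \<Longrightarrow> P z"
  shows "P y"
  using assms unfolding conn_def by (induction rule: rtrancl_induct) auto

lemma conn_closed:
  assumes "(x, y) \<in> conn F" "\<Union>F \<subseteq> V" "x \<in> V"
  shows "y \<in> V"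
  using assms by (induction rule: conn_induct) auto

lemma conn_least:
  assumes "\<And>x y. {x, y} \<in> F \<Longrightarrow> (x, y) \<in> conn F'"
  shows "conn F \<subseteq> conn F'"
proof (rule subrelI)
  fix x y assume "(x, y) \<in> conn F"
  then show "(x, y) \<in> conn F'"
    by (induction rule: conn_induct) (auto intro: assms conn_trans)
qed

text \<open>A walk needs the new edge at most once. The undirected edge contributes two ordered
  pairs, whence two uses of \<open>rtrancl_insert\<close>.\<close>

lemma conn_insert:
  "(u, v) \<in> conn (insert {a, b} F) \<longleftrightarrow> (u, v) \<in> conn F \<or>
     (u, a) \<in> conn F \<and> (b, v) \<in> conn F \<or> (u, b) \<in> conn F \<and> (a, v) \<in> conn F"
proof -
  have "{(x, y). {x, y} \<in> insert {a, b} F} = insert (a, b) (insert (b, a) {(x, y). {x, y} \<in> F})"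
    by (auto simp: doubleton_eq_iff)
  then show ?thesis
    unfolding conn_def by (auto simp: rtrancl_insert intro: rtrancl_trans)
qed

text \<open>The closure operator of the cycle matroid. Sets that are not of the form \<open>{u, v}\<close> belong to
  every span, like loops.\<close>
definition cycle_span :: "'a set set \<Rightarrow> 'a set set" where
  "cycle_span F = {e. \<forall>u v. e = {u, v} \<longrightarrow> (u, v) \<in> conn F}"

lemma conn_cycle_span: "conn (cycle_span F) \<subseteq> conn F"
  by (rule conn_least) (auto simp: cycle_span_def)

interpretation cycle_matroid: matroid_span cycle_span
proof
  show "cycle_span A \<subseteq> cycle_span B" if "A \<subseteq> B" for A B :: "'a set set"
    using conn_mono[OF that] by (auto simp: cycle_span_def)
  show "A \<subseteq> cycle_span A" for A :: "'a set set"
    by (auto simp: cycle_span_def intro: conn_edge)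
  show "cycle_span (cycle_span A) \<subseteq> cycle_span A" for A :: "'a set set"
    using conn_cycle_span[of A] by (auto simp: cycle_span_def)
  show "y \<in> cycle_span (insert x A)"
    if x: "x \<in> cycle_span (insert y A)" "x \<notin> cycle_span A" for x y :: "'a set" and A
    unfolding cycle_span_def
  proof (intro CollectI allI impI)
    fix a b assume y: "y = {a, b}"
    obtain u v where uv: "x = {u, v}" "(u, v) \<notin> conn A"
      using x(2) by (auto simp: cycle_span_def)
    then have "(u, v) \<in> conn (insert {a, b} A)"
      using x(1) y by (auto simp: cycle_span_def)
    \<comment> \<open>By \<open>conn_insert\<close>, \<open>u\<close> and \<open>v\<close> are
      joined within \<open>A\<close> to different ends of \<open>y\<close>; the edge
      \<open>x\<close> links these two connections.\<close>
    then show "(a, b) \<in> conn (insert x A)"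
      using uv(2) unfolding uv(1) conn_insert by (auto intro: conn_sym)
  qed
qed

abbreviation forest :: "'a set set \<Rightarrow> bool" where
  "forest \<equiv> cycle_matroid.indep"

section \<open>Components and the size of a forest\<close>

definition components :: "'a set \<Rightarrow> 'a set set \<Rightarrow> 'a set set" where
  "components V F = (\<lambda>v. conn F `` {v}) ` V"

lemma conn_class_eq: "(u, v) \<in> conn F \<Longrightarrow> conn F `` {u} = conn F `` {v}"
  by (auto intro: conn_trans conn_sym)

lemma partition_on_components:
  assumes "\<Union>F \<subseteq> V"
  shows "partition_on V (components V F)"
proof (rule partition_onI)
  show "\<Union>(components V F) = V"
    unfolding components_def using conn_closed[OF _ assms] by fastforce
  show "disjnt p q" if pq: "p \<in> components V F" "q \<in> components V F" "p \<noteq> q" for p q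
  proof (rule ccontr)
    assume "\<not> disjnt p q"
    moreover obtain u v where "p = conn F `` {u}" "q = conn F `` {v}"
      using pq(1,2) unfolding components_def by blast
    moreover from this obtain w where "(u, w) \<in> conn F" "(v, w) \<in> conn F"
      using \<open>\<not> disjnt p q\<close> by (auto simp: disjnt_def)
    ultimately show False using conn_class_eq pq(3) by metis
  qed
  show "{} \<notin> components V F"
  proof
    assume "{} \<in> components V F"
    then obtain v where "conn F `` {v} = {}" by (auto simp: components_def)
    then show False using conn_refl[of v F] by blast
  qed
qed

text \<open>The classes \<open>A\<close> and \<open>B\<close> of the two ends merge, and all other
  classes stay as they are.\<close>

lemma card_components_insert:
  assumes "finite V" "a \<in> V" "b \<in> V" "(a, b) \<notin> conn F"
  shows "Suc (card (components V (insert {a, b} F))) = card (components V F)"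
proof -
  define A where "A = conn F `` {a}"
  define B where "B = conn F `` {b}"
  have AB: "A \<noteq> B" "A \<in> components V F" "B \<in> components V F"
    using assms unfolding A_def B_def components_def by (auto intro: conn_refl)
  have merged: "conn (insert {a, b} F) `` {v} = (if v \<in> A \<union> B then A \<union> B else conn F `` {v})" for v
  proof (cases "v \<in> A \<union> B")
    case True
    then have "(v, a) \<in> conn F \<or> (v, b) \<in> conn F"
      unfolding A_def B_def by (auto intro: conn_sym)
    then show ?thesis
      using True unfolding A_def B_def by (auto simp: conn_insert intro: conn_trans)
  next
    case False
    then have "(v, a) \<notin> conn F" "(v, b) \<notin> conn F"
      unfolding A_def B_def by (auto dest: conn_sym)
    then show ?thesis
      using False by (auto simp: conn_insert)
  qed
  have other: "conn F `` {v} \<in> {A, B} \<longleftrightarrow> v \<in> A \<union> B" for v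
    unfolding A_def B_def using conn_class_eq conn_sym by fastforce
  have "components V (insert {a, b} F) = insert (A \<union> B) (components V F - {A, B})"
    unfolding components_def
  proof (intro equalityI subsetI)
    fix X assume "X \<in> (\<lambda>v. conn (insert {a, b} F) `` {v}) ` V"
    then obtain v where v: "v \<in> V" "X = conn (insert {a, b} F) `` {v}" by blast
    then show "X \<in> insert (A \<union> B) ((\<lambda>v. conn F `` {v}) ` V - {A, B})"
      using other[of v] merged[of v] by (cases "v \<in> A \<union> B") auto
  next
    fix X assume X: "X \<in> insert (A \<union> B) ((\<lambda>v. conn F `` {v}) ` V - {A, B})"
    show "X \<in> (\<lambda>v. conn (insert {a, b} F) `` {v}) ` V"
    proof (cases "X = A \<union> B")
      case True
      have "a \<in> A" by (simp add: A_def)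
      then show ?thesis using True merged[of a] assms(2) by auto
    next
      case False
      then obtain v where v: "v \<in> V" "X = conn F `` {v}" "X \<notin> {A, B}" using X by blast
      then show ?thesis using other[of v] merged[of v] by auto
    qed
  qed
  \<comment> \<open>The union is a new class: a representative of it would lie in \<open>A\<close>
    or \<open>B\<close> and hence have that set as its old class.\<close>
  moreover have "A \<union> B \<notin> components V F - {A, B}"
  proof
    assume "A \<union> B \<in> components V F - {A, B}"
    then obtain v where v: "A \<union> B = conn F `` {v}" "conn F `` {v} \<notin> {A, B}"
      unfolding components_def by auto
    moreover have "v \<in> A \<union> B" using v(1) by simp
    ultimately show False using other[of v] by blast
  qed
  moreover have fin: "finite (components V F)"
    using assms(1) by (simp add: components_def)
  moreover have "card (components V F - {A, B}) = card (components V F) - 2"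
    using AB fin by (subst card_Diff_subset) auto
  moreover have "2 \<le> card (components V F)"
    using card_mono[OF fin, of "{A, B}"] AB by auto
  ultimately show ?thesis by simp
qed

text \<open>Starting from singleton components, each edge of a forest joins two different
  components.\<close>

lemma forest_card:
  assumes "finite V" "finite F" "forest F" "\<And>e. e \<in> F \<Longrightarrow> e \<subseteq> V \<and> card e = 2"
  shows "card F + card (components V F) = card V"
  using assms(2-)
proof (induction F)
  case empty
  have "conn {} = Id" by (simp add: conn_def)
  then have "components V {} = (\<lambda>v. {v}) ` V" by (auto simp: components_def)
  then show ?case by (simp add: card_image)
next
  case (insert e F)
  obtain a b where ab: "e = {a, b}" "a \<in> V" "b \<in> V"
    using insert.prems(2)[of e] by (auto simp: card_2_iff)
  have "e \<notin> cycle_span F"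
    using insert.prems(1) insert.hyps(2) unfolding cycle_matroid.indep_def by auto
  then have "(a, b) \<notin> conn F"
    using ab(1) by (auto simp: cycle_span_def doubleton_eq_iff dest: conn_sym)
  then have "Suc (card (components V (insert e F))) = card (components V F)"
    using card_components_insert[OF assms(1)] ab by simp
  moreover have "card F + card (components V F) = card V"
    using insert cycle_matroid.indep_subset by blast
  ultimately show ?case using insert.hyps by simp
qed

text \<open>The nontrivial direction of the theorem of Nash-Williams and Tutte.\<close>
theorem tree_packing:
  assumes V: "finite V" "V \<noteq> {}"
    and E: "\<And>e. e \<in> E \<Longrightarrow> e \<subseteq> V \<and> card e = 2"
    and cross: "\<And>P. partition_on V P \<Longrightarrow> k * (card P - 1) \<le> card {e \<in> E. \<forall>X\<in>P. \<not> e \<subseteq> X}"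
  obtains I where "\<forall>i<k. I i \<subseteq> E \<and> V \<times> V \<subseteq> conn (I i)" "disjoint_family_on I {..<k}"
proof -
  have finE: "finite E"
    using V(1) E by (meson PowI finite_Pow_iff finite_subset subsetI)
  obtain I R where I: "cycle_matroid.packing E k I" and R: "R \<subseteq> E" "E - (\<Union>i<k. I i) \<subseteq> R"
    and span: "\<And>i. i < k \<Longrightarrow> R \<subseteq> cycle_span (I i \<inter> R)"
    using cycle_matroid.packing_tight_set[OF finE] by metis
  have sub: "I i \<subseteq> E" and forest: "forest (I i)" if "i < k" for i
    using I that by (auto simp: cycle_matroid.packing_def)
  have finI: "finite (I i)" if "i < k" for i
    using sub[OF that] finE by (rule finite_subset)
  have disj: "disjoint_family_on I {..<k}"
    using I by (simp add: cycle_matroid.packing_def)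
  \<comment> \<open>The components of the tight set \<open>R\<close> are the partition to test. By
    tightness every \<open>I i \<inter> R\<close> has these same components.\<close>
  define P where "P = components V R"
  have P: "partition_on V P"
    unfolding P_def using R(1) E by (intro partition_on_components) blast
  have finP: "finite P" "card P \<noteq> 0"
    using V by (auto simp: P_def components_def)
  have inside: "card (I i \<inter> R) + card P = card V" if i: "i < k" for i
  proof -
    have "conn R \<subseteq> conn (I i \<inter> R)"
      using conn_mono[OF span[OF i]] conn_cycle_span by blast
    then have "conn (I i \<inter> R) = conn R"
      using conn_mono[of "I i \<inter> R" R] by blast
    then have "components V (I i \<inter> R) = P"
      by (simp add: P_def components_def)
    moreover have "forest (I i \<inter> R)"
      using forest[OF i] by (rule cycle_matroid.indep_subset) blast
    ultimately show ?thesis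
      using forest_card[of V "I i \<inter> R"] V(1) finI[OF i] sub[OF i] E by auto
  qed
  have total: "card (I i) + card (components V (I i)) = card V" if i: "i < k" for i
    using forest_card[of V "I i"] V(1) finI[OF i] sub[OF i] E forest[OF i] by blast
  have upper: "card (I i) \<le> card V - 1" if i: "i < k" for i
  proof -
    have "card (components V (I i)) \<noteq> 0"
      using V by (auto simp: components_def)
    then show ?thesis using total[OF i] by simp
  qed
  \<comment> \<open>The ends of an edge of \<open>R\<close> share a component, so a crossing edge
    avoids \<open>R\<close> and is therefore covered by the packing.\<close>
  have "{e \<in> E. \<forall>X\<in>P. \<not> e \<subseteq> X} \<subseteq> (\<Union>i<k. I i - R)"
  proof
    fix e assume e: "e \<in> {e \<in> E. \<forall>X\<in>P. \<not> e \<subseteq> X}"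
    have "e \<notin> R"
    proof
      assume "e \<in> R"
      obtain u v where uv: "e = {u, v}" "u \<in> V"
        using e E[of e] by (auto simp: card_2_iff)
      then have "e \<subseteq> conn R `` {u}"
        using \<open>e \<in> R\<close> by (auto intro: conn_edge)
      then show False using e uv(2) unfolding P_def components_def by blast
    qed
    then show "e \<in> (\<Union>i<k. I i - R)" using e R(2) by blast
  qed
  then have "card {e \<in> E. \<forall>X\<in>P. \<not> e \<subseteq> X} \<le> card (\<Union>i<k. I i - R)"
    using finI by (intro card_mono) auto
  also have "\<dots> \<le> (\<Sum>i<k. card (I i - R))"
    by (rule card_UN_le) simp
  finally have outside: "k * (card P - 1) \<le> (\<Sum>i<k. card (I i - R))"
    using cross[OF P] by linarith
  \<comment> \<open>The forests have k(|V| - |P|) edges inside \<open>R\<close> and at least k(|P| -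
    1) outside. Together this is the most that k forests on V can have.\<close>
  have "k * (card V - 1) = (\<Sum>i<k. card (I i \<inter> R)) + k * (card P - 1)"
  proof -
    have "(\<Sum>i<k. card (I i \<inter> R)) = (\<Sum>i<k. card V - card P)"
      using inside by (intro sum.cong refl) (metis diff_add_inverse2 lessThan_iff)
    moreover have "k * (card V - 1) = k * (card V - card P) + k * (card P - 1)"
    proof (cases "k = 0")
      case False
      then have "card P \<le> card V" using inside[of 0] by simp
      then have "card V - 1 = (card V - card P) + (card P - 1)" using finP(2) by linarith
      then show ?thesis by (metis add_mult_distrib2)
    qed simp
    ultimately show ?thesis by simp
  qed
  also have "\<dots> \<le> (\<Sum>i<k. card (I i \<inter> R)) + (\<Sum>i<k. card (I i - R))"
    using outside by simp
  also have "\<dots> = (\<Sum>i<k. card (I i))"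
    using finI by (simp add: sum.distrib[symmetric] card_Int_Diff[symmetric])
  finally have lower: "k * (card V - 1) \<le> (\<Sum>i<k. card (I i))" .
  have spanning: "V \<times> V \<subseteq> conn (I i)" if i: "i < k" for i
  proof -
    \<comment> \<open>One smaller forest would already push the total below the lower bound.\<close>
    have "card (I i) = card V - 1"
    proof (rule ccontr)
      assume "card (I i) \<noteq> card V - 1"
      then have "(\<Sum>i<k. card (I i)) < (\<Sum>i<k. card V - 1)"
        using upper i by (intro sum_strict_mono_ex1) (auto simp: less_le)
      then show False using lower by simp
    qed
    then have "card (components V (I i)) = 1"
      using total[OF i] V by (metis Nat.add_diff_assoc One_nat_def Suc_leI add_diff_cancel_left'
          card_gt_0_iff diff_diff_cancel)
    then obtain X where X: "components V (I i) = {X}"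
      by (auto simp: card_1_singleton_iff)
    show ?thesis
    proof (rule subrelI)
      fix u v assume "(u, v) \<in> V \<times> V"
      then have "conn (I i) `` {u} \<in> {X}" "conn (I i) `` {v} \<in> {X}"
        unfolding X[symmetric] components_def by auto
      then have "conn (I i) `` {v} \<subseteq> conn (I i) `` {u}" by simp
      then show "(u, v) \<in> conn (I i)" using conn_refl[of v "I i"] by blast
    qed
  qed
  show thesis using that[of I] sub spanning disj by simp
qed

section \<open>Walks, cuts and rooted trees\<close>

definition edge_boundary :: "'a ugraph \<Rightarrow> 'a set \<Rightarrow> 'a set set" where
  "edge_boundary G X = {e \<in> edges G. e \<inter> X \<noteq> {} \<and> \<not> e \<subseteq> X}"

text \<open>Each part has at least 2k boundary edges and each crossing edge meets at most two parts,
  so at least k|P| edges cross. Deleting \<open>S\<close> costs at most k of them.\<close>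

lemma crossing_edges_ge:
  assumes G: "simple_graph G"
    and cut: "\<And>X. X \<noteq> {} \<Longrightarrow> X \<subset> verts G \<Longrightarrow> 2 * k \<le> card (edge_boundary G X)"
    and S: "S \<subseteq> edges G" "card S \<le> k"
    and P: "partition_on (verts G) P"
  shows "k * (card P - 1) \<le> card {e \<in> edges G - S. \<forall>X\<in>P. \<not> e \<subseteq> X}"
proof (cases "card P \<le> 1")
  case False
  have finV: "finite (verts G)" and E: "\<And>e. e \<in> edges G \<Longrightarrow> e \<subseteq> verts G \<and> card e = 2"
    using G by (auto simp: simple_graph_def)
  have finE: "finite (edges G)"
    using finV E by (meson PowI finite_Pow_iff finite_subset subsetI)
  have finP: "finite P"
    using False card.infinite by fastforce
  define C where "C = {e \<in> edges G. \<forall>X\<in>P. \<not> e \<subseteq> X}"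
  have finC: "finite C" using finE by (simp add: C_def)
  have unique: "X = Y" if "X \<in> P" "Y \<in> P" "x \<in> X" "x \<in> Y" for X Y x
    using P that by (meson disjoint_iff disjointD partition_onD2)
  have part: "2 * k \<le> card {e \<in> C. e \<inter> X \<noteq> {}}" if X: "X \<in> P" for X
  proof -
    obtain Y where Y: "Y \<in> P" "Y \<noteq> X"
      using False X by (metis card_le_Suc0_iff_eq finP One_nat_def)
    have ne: "X \<noteq> {}" "Y \<noteq> {}" using P X Y by (auto dest: partition_onD3)
    have "X \<union> Y \<subseteq> verts G" using P X Y by (auto dest: partition_onD1)
    moreover have "X \<inter> Y = {}" using unique X Y by blast
    ultimately have "2 * k \<le> card (edge_boundary G X)"
      using ne by (intro cut) auto
    also have "edge_boundary G X = {e \<in> C. e \<inter> X \<noteq> {}}"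
    proof -
      have "\<not> e \<subseteq> Z" if "e \<inter> X \<noteq> {}" "\<not> e \<subseteq> X" "Z \<in> P" for e Z
        using that unique X by blast
      then show ?thesis using X unfolding edge_boundary_def C_def by blast
    qed
    finally show ?thesis .
  qed
  have "2 * k * card P = (\<Sum>X\<in>P. 2 * k)" by simp
  also have "\<dots> \<le> (\<Sum>X\<in>P. card {e \<in> C. e \<inter> X \<noteq> {}})"
    by (rule sum_mono) (rule part)
  also have "\<dots> = (\<Sum>e\<in>C. card {X \<in> P. e \<inter> X \<noteq> {}})"
    by (rule sum_multicount_gen) (use finP finC in auto)
  also have "\<dots> \<le> (\<Sum>e\<in>C. 2)"
  proof (rule sum_mono)
    fix e assume "e \<in> C"
    then obtain u v where uv: "e = {u, v}" "u \<in> verts G" "v \<in> verts G"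
      using E[of e] by (auto simp: C_def card_2_iff)
    then obtain X Y where "X \<in> P" "u \<in> X" "Y \<in> P" "v \<in> Y"
      using partition_onD1[OF P] by blast
    then have "{X \<in> P. e \<inter> X \<noteq> {}} \<subseteq> {X, Y}"
      using unique uv(1) by blast
    then have "card {X \<in> P. e \<inter> X \<noteq> {}} \<le> card {X, Y}"
      by (intro card_mono) auto
    also have "\<dots> \<le> 2" by (simp add: card_insert_if)
    finally show "card {X \<in> P. e \<inter> X \<noteq> {}} \<le> 2" .
  qed
  finally have "k * card P \<le> card C" by simp
  moreover have "card C - card S \<le> card (C - S)"
    using S(1) finE by (intro diff_card_le_card_Diff) (auto intro: finite_subset)
  moreover have "C - S = {e \<in> edges G - S. \<forall>X\<in>P. \<not> e \<subseteq> X}" by (auto simp: C_def)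
  ultimately show ?thesis
    using S(2) by (simp add: diff_mult_distrib2)
qed simp

section \<open>Reachability and paths as vertex lists\<close>

lemma conn_walk:
  assumes "p \<noteq> []" "walk_edges p \<subseteq> F"
  shows "(hd p, last p) \<in> conn F"
  using assms
proof (induction p rule: walk_edges.induct)
  case (3 x y xs)
  then show ?case using conn_edge[of x y F] by (auto intro: conn_trans)
qed auto

lemma walk_edges_append:
  assumes "xs \<noteq> []" "ys \<noteq> []"
  shows "walk_edges (xs @ ys) = insert {last xs, hd ys} (walk_edges xs \<union> walk_edges ys)"
  using assms
proof (induction xs rule: walk_edges.induct)
  case (2 x)
  then show ?case by (cases ys) auto
qed auto

text \<open>A path is extended step by step; if the next vertex was already visited, the path is cut
  back to it. The start \<open>u\<close> is listed separately because a one-vertex path may meet no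
  edge.\<close>

lemma conn_path:
  assumes "(u, v) \<in> conn F"
  obtains p where "p \<noteq> []" "distinct p" "hd p = u" "last p = v" "walk_edges p \<subseteq> F"
    "set p \<subseteq> insert u (\<Union>F)"
proof -
  have "\<exists>p. p \<noteq> [] \<and> distinct p \<and> hd p = u \<and> last p = v \<and> walk_edges p \<subseteq> F
      \<and> set p \<subseteq> insert u (\<Union>F)"
    using assms
  proof (induction rule: conn_induct)
    case refl
    show ?case by (rule exI[of _ "[u]"]) simp
  next
    case (step y z)
    then obtain p where p: "p \<noteq> []" "distinct p" "hd p = u" "last p = y" "walk_edges p \<subseteq> F"
      "set p \<subseteq> insert u (\<Union>F)" by blast
    show ?case
    proof (cases "z \<in> set p")
      case True
      then obtain xs ys where "p = xs @ z # ys" by (auto simp: in_set_conv_decomp)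
      then have eq: "p = (xs @ [z]) @ ys" by simp
      have "walk_edges (xs @ [z]) \<subseteq> walk_edges p"
        unfolding eq by (cases "ys = []") (auto simp: walk_edges_append simp del: append_assoc)
      moreover have "hd (xs @ [z]) = u" using p(3) unfolding eq by (cases xs) auto
      ultimately show ?thesis
        using p unfolding eq by (intro exI[of _ "xs @ [z]"]) auto
    next
      case False
      then show ?thesis
        using p step.hyps(2) by (intro exI[of _ "p @ [z]"]) (auto simp: walk_edges_append)
    qed
  qed
  then show thesis using that by blast
qed

lemma graph_connected_iff_conn:
  assumes "\<Union>(edges G) \<subseteq> verts G"
  shows "graph_connected G \<longleftrightarrow> verts G \<noteq> {} \<and> verts G \<times> verts G \<subseteq> conn (edges G)"
proof -
  have "(\<exists>p. is_path G u p v) \<longleftrightarrow> (u, v) \<in> conn (edges G)" if u: "u \<in> verts G" for u v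
  proof
    assume "\<exists>p. is_path G u p v"
    then show "(u, v) \<in> conn (edges G)"
      unfolding is_path_def is_walk_def using conn_walk by blast
  next
    assume "(u, v) \<in> conn (edges G)"
    then show "\<exists>p. is_path G u p v"
      using u assms unfolding is_path_def is_walk_def by (elim conn_path) blast
  qed
  then show ?thesis unfolding graph_connected_def by blast
qed

lemma walk_interior_neighbours:
  assumes "distinct p" "x \<in> set p" "x \<noteq> hd p" "x \<noteq> last p"
  obtains a b where "a \<in> set p" "b \<in> set p" "a \<noteq> b" "{a, x} \<in> walk_edges p" "{x, b} \<in> walk_edges p"
proof -
  obtain ys zs where p: "p = ys @ x # zs" using assms(2) by (auto simp: in_set_conv_decomp)
  have ne: "ys \<noteq> []" "zs \<noteq> []" using assms(3,4) p by auto
  show thesis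
  proof
    show "last ys \<in> set p" "hd zs \<in> set p" using ne p by auto
    show "last ys \<noteq> hd zs"
      using assms(1) p last_in_set[OF ne(1)] hd_in_set[OF ne(2)] by (auto simp: disjoint_iff)
    show "{last ys, x} \<in> walk_edges p" using ne p by (simp add: walk_edges_append)
    show "{x, hd zs} \<in> walk_edges p"
      using ne p walk_edges_append[of "[x]" zs] by (simp add: walk_edges_append)
  qed
qed

text \<open>At the two ends of the list the closing edge supplies one neighbour; length at least 3
  keeps the two neighbours distinct.\<close>

lemma cycle_neighbours:
  assumes "is_cycle G p" "x \<in> set p"
  obtains a b where "a \<in> set p" "b \<in> set p" "a \<noteq> b" "{a, x} \<in> edges G" "{x, b} \<in> edges G"
proof -
  have d: "distinct p" and w: "walk_edges p \<subseteq> edges G" and l: "3 \<le> length p"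
    and c: "{last p, hd p} \<in> edges G"
    using assms(1) by (auto simp: is_cycle_def is_walk_def)
  consider "x = hd p" | "x = last p" | "x \<noteq> hd p" "x \<noteq> last p" by blast
  then show thesis
  proof cases
    case 1
    obtain y z zs where p: "p = x # y # z # zs"
      using l 1 by (auto simp: numeral_3_eq_3 Suc_le_length_iff)
    have "last p \<noteq> y" using d p last_in_set[of "z # zs"] by auto
    then show ?thesis
      using that[of "last p" y] p c w last_in_set[of p] by auto
  next
    case 2
    obtain ys where ys: "p = ys @ [x]" using 2 l by (cases p rule: rev_cases) auto
    then obtain zs y where p: "p = (zs @ [y]) @ [x]" using l by (cases ys rule: rev_cases) auto
    then obtain z zs' where zs: "zs = z # zs'" using l by (cases zs) auto
    have "{y, x} \<in> walk_edges p" unfolding p by (subst walk_edges_append) auto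
    then show ?thesis
      using that[of y z] d c w p zs by (auto simp: insert_commute)
  next
    case 3
    obtain a b where "a \<in> set p" "b \<in> set p" "a \<noteq> b" "{a, x} \<in> walk_edges p" "{x, b} \<in> walk_edges p"
      by (rule walk_interior_neighbours[OF d assms(2) 3])
    then show ?thesis using w by (intro that[of a b]) auto
  qed
qed

text \<open>Parents decrease the potential \<open>d\<close>, so every vertex reaches
  \<open>r\<close>. On a cycle, a vertex of largest \<open>d\<close> would have two distinct
  neighbours, both equal to its parent.\<close>

lemma is_tree_parent:
  fixes d :: "'a \<Rightarrow> nat"
  assumes "finite V" "r \<in> V" and par: "\<And>v. v \<in> V - {r} \<Longrightarrow> \<pi> v \<in> V \<and> d (\<pi> v) < d v"
  shows "is_tree \<lparr>verts = V, edges = (\<lambda>v. {v, \<pi> v}) ` (V - {r})\<rparr>" (is "is_tree ?T")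
  unfolding is_tree_def
proof (intro conjI notI)
  show "simple_graph ?T"
    unfolding simple_graph_def using assms by (fastforce simp: card_2_iff)
  have root: "(v, r) \<in> conn (edges ?T)" if "v \<in> V" for v
    using that
  proof (induction "d v" arbitrary: v rule: less_induct)
    case less
    show ?case
    proof (cases "v = r")
      case False
      then have "(v, \<pi> v) \<in> conn (edges ?T)" "(\<pi> v, r) \<in> conn (edges ?T)"
        using less par by (auto intro: conn_edge)
      then show ?thesis by (rule conn_trans)
    qed simp
  qed
  show "graph_connected ?T"
  proof (subst graph_connected_iff_conn)
    show "\<Union>(edges ?T) \<subseteq> verts ?T" using par by auto
    show "verts ?T \<noteq> {} \<and> verts ?T \<times> verts ?T \<subseteq> conn (edges ?T)"
      using assms(2) root by (auto intro: conn_trans conn_sym)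
  qed
  assume "\<exists>p. is_cycle ?T p"
  then obtain p where p: "is_cycle ?T p" ..
  then have "p \<noteq> []" by (auto simp: is_cycle_def)
  then have "Max (d ` set p) \<in> d ` set p" by simp
  then obtain x where x: "x \<in> set p" "d x = Max (d ` set p)" by auto
  then have max: "d y \<le> d x" if "y \<in> set p" for y using that by simp
  obtain a b where ab: "a \<in> set p" "b \<in> set p" "a \<noteq> b" "{a, x} \<in> edges ?T" "{x, b} \<in> edges ?T"
    by (rule cycle_neighbours[OF p x(1)])
  have "y = \<pi> x" if y: "y \<in> set p" "{y, x} \<in> edges ?T" for y
  proof -
    obtain v where v: "v \<in> V - {r}" "{y, x} = {v, \<pi> v}" using y(2) by auto
    then have "y = v \<Longrightarrow> x = \<pi> v \<Longrightarrow> False" using par[of v] max[OF y(1)] by auto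
    then show ?thesis using v(2) by (auto simp: doubleton_eq_iff)
  qed
  then show False using ab by (metis insert_commute)
qed

text \<open>Parents in a breadth-first search from \<open>r\<close>; \<open>d\<close> is the distance from \<open>r\<close>.\<close>
lemma rooted_parents:
  fixes F :: "'a set set" and r :: 'a
  obtains d :: "'a \<Rightarrow> nat" and \<pi> where
    "\<And>v. (r, v) \<in> conn F \<Longrightarrow> v \<noteq> r \<Longrightarrow> {v, \<pi> v} \<in> F \<and> d (\<pi> v) < d v"
proof -
  define A where "A = {(x, y). {x, y} \<in> F}"
  define d where "d v = (LEAST n. (r, v) \<in> A ^^ n)" for v
  have "\<exists>y. {v, y} \<in> F \<and> d y < d v" if v: "(r, v) \<in> conn F" "v \<noteq> r" for v
  proof -
    have "\<exists>n. (r, v) \<in> A ^^ n"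
      using v(1) rtrancl_imp_relpow unfolding conn_def A_def by blast
    then have dv: "(r, v) \<in> A ^^ d v" unfolding d_def by (rule LeastI_ex)
    then obtain m where m: "d v = Suc m" using v(2) by (cases "d v") auto
    then obtain y where y: "(r, y) \<in> A ^^ m" "(y, v) \<in> A" using dv by auto
    then have "d y \<le> m" unfolding d_def by (intro Least_le)
    then show ?thesis using y(2) m unfolding A_def by (auto simp: insert_commute intro!: exI[of _ y])
  qed
  then show thesis using that by metis
qed

section \<open>Edge-connectivity of a graph with highly connected line graph\<close>

lemma k_connected_delete_verts:
  assumes "k_connected m H" "B \<subseteq> verts H" "card B < m"
  shows "graph_connected (delete_verts H B)"
proof -
  have "card B < (LEAST n. \<exists>S\<subseteq>verts H. card S = n \<and>
      (\<not> graph_connected (delete_verts H S) \<or> card (verts H - S) \<le> 1))"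
    using assms(1,3) unfolding k_connected_def vertex_connectivity_def by linarith
  from not_less_Least[OF this] assms(2)
  show ?thesis by blast
qed

text \<open>As a vertex set of the line graph, the boundary separates \<open>e\<close> from
  \<open>f\<close>: an edge outside the boundary that meets an edge inside \<open>X\<close> lies
  inside \<open>X\<close> itself.\<close>

lemma k_connected_line_graph_edge_boundary:
  assumes "simple_graph G" "k_connected m (line_graph G)"
    and e: "e \<in> edges G" "e \<subseteq> X" and f: "f \<in> edges G" "f \<inter> X = {}"
  shows "m \<le> card (edge_boundary G X)"
proof (rule ccontr)
  assume "\<not> m \<le> card (edge_boundary G X)"
  then have conn: "graph_connected (delete_verts (line_graph G) (edge_boundary G X))" (is "graph_connected ?D")
    using assms(2) by (intro k_connected_delete_verts) (auto simp: line_graph_def edge_boundary_def)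
  have ne: "e \<noteq> {}" "f \<noteq> {}"
    using assms(1) e(1) f(1) by (auto simp: simple_graph_def)
  have "e \<in> verts ?D" "f \<in> verts ?D"
    using e f ne by (auto simp: delete_verts_def line_graph_def edge_boundary_def)
  moreover have "\<Union>(edges ?D) \<subseteq> verts ?D"
    by (auto simp: delete_verts_def line_graph_def)
  ultimately have "(e, f) \<in> conn (edges ?D)"
    using conn graph_connected_iff_conn by blast
  then have "f \<subseteq> X"
  proof (induction rule: conn_induct)
    case refl
    show ?case by (rule e)
  next
    case (step g h)
    then have "g \<inter> h \<noteq> {}" "h \<in> edges G" "h \<notin> edge_boundary G X"
      by (auto simp: delete_verts_def line_graph_def doubleton_eq_iff)
    then show ?case using step(3) unfolding edge_boundary_def by blast
  qed
  then show False using f ne by blast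
qed

lemma is_edge_cut_edge_boundary:
  assumes "simple_graph G" "X \<noteq> {}" "X \<subset> verts G"
  shows "is_edge_cut G (edge_boundary G X)"
  unfolding is_edge_cut_def
proof
  show "edge_boundary G X \<subseteq> edges G" by (auto simp: edge_boundary_def)
  obtain x y where xy: "x \<in> X" "y \<in> verts G" "y \<notin> X" using assms(2,3) by blast
  let ?D = "delete_edges G (edge_boundary G X)"
  have "z \<in> X" if "(x, z) \<in> conn (edges ?D)" for z
    using that xy(1)
    by (induction rule: conn_induct) (auto simp: delete_edges_def edge_boundary_def)
  then have "(x, y) \<notin> conn (edges ?D)" using xy by blast
  moreover have "\<Union>(edges ?D) \<subseteq> verts ?D" "x \<in> verts ?D" "y \<in> verts ?D"
    using assms xy by (auto simp: delete_edges_def simple_graph_def)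
  ultimately show "\<not> graph_connected ?D" using graph_connected_iff_conn by blast
qed

text \<open>\<open>X\<close> is a component left by \<open>F\<close>. Since \<open>F\<close>
  isolates no vertex, a surviving edge exists both in \<open>X\<close> and at a vertex outside
  it.\<close>

lemma nonisolating_edge_cut_edge_boundary:
  assumes G: "simple_graph G" and F: "is_edge_cut G F" "\<not> isolates_vertex G F" and V: "verts G \<noteq> {}"
  obtains X e f where "edge_boundary G X \<subseteq> F" "e \<in> edges G" "e \<subseteq> X" "f \<in> edges G" "f \<inter> X = {}"
proof -
  let ?E = "edges G - F"
  have E: "\<exists>w. e = {u, w}" if "e \<in> edges G" "u \<in> e" for e u
    using G that by (auto simp: simple_graph_def card_2_iff)
  have "\<Union>(edges (delete_edges G F)) \<subseteq> verts (delete_edges G F)"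
    using G by (auto simp: delete_edges_def simple_graph_def)
  then obtain u v where uv: "u \<in> verts G" "v \<in> verts G" "(u, v) \<notin> conn ?E"
    using F(1) V graph_connected_iff_conn[of "delete_edges G F"]
    by (auto simp: is_edge_cut_def delete_edges_def)
  have "\<exists>e\<in>?E. w \<in> e" if "w \<in> verts G" for w
    using F(2) that by (auto simp: isolates_vertex_def delete_edges_def)
  then obtain e f where ef: "e \<in> ?E" "u \<in> e" "f \<in> ?E" "v \<in> f" using uv by meson
  define X where "X = conn ?E `` {u}"
  have step: "b \<in> X" if "a \<in> X" "{a, b} \<in> ?E" for a b
    using that by (auto simp: X_def intro: conn_trans conn_edge)
  have closed: "g \<subseteq> X" if "g \<in> ?E" "a \<in> g" "a \<in> X" for g a
    using E[of g a] step that by auto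
  show thesis
  proof (rule that)
    show "edge_boundary G X \<subseteq> F" using closed unfolding edge_boundary_def by blast
    show "e \<in> edges G" "f \<in> edges G" using ef by auto
    show "e \<subseteq> X" using closed[of e u] ef by (simp add: X_def)
    show "f \<inter> X = {}" using closed[of f] ef uv(3) unfolding X_def by blast
  qed
qed

text \<open>In the first case a minimum cut isolating no vertex contains a boundary with edges on
  both sides, so it has at least m edges, and so has every cut. In the second case only a side
  without edges needs care: there all edges at any vertex cross the boundary.\<close>

lemma edge_boundary_ge_connectivity_line_graph:
  assumes G: "simple_graph G" and L: "k_connected m (line_graph G)"
    and H: "(graph_connected G \<and> \<not> super_edge_connected G) \<or> m \<le> min_degree G"
    and X: "X \<noteq> {}" "X \<subset> verts G"
  shows "m \<le> card (edge_boundary G X)"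
  using H
proof
  have finE: "finite (edges G)"
    using G unfolding simple_graph_def by (meson PowI finite_Pow_iff finite_subset subsetI)
  {
    assume "graph_connected G \<and> \<not> super_edge_connected G"
    then obtain F where F: "is_minimum_edge_cut G F" "\<not> isolates_vertex G F"
      unfolding super_edge_connected_def by blast
    then have cut: "is_edge_cut G F" by (simp add: is_minimum_edge_cut_def)
    have "verts G \<noteq> {}" using X by blast
    then obtain Y e f where Y: "edge_boundary G Y \<subseteq> F" "e \<in> edges G" "e \<subseteq> Y" "f \<in> edges G" "f \<inter> Y = {}"
      by (rule nonisolating_edge_cut_edge_boundary[OF G cut F(2)])
    have "m \<le> card (edge_boundary G Y)"
      by (rule k_connected_line_graph_edge_boundary[OF G L Y(2-)])
    also have "\<dots> \<le> card F"
      using Y(1) cut finE by (intro card_mono) (auto simp: is_edge_cut_def intro: finite_subset)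
    also have "\<dots> \<le> card (edge_boundary G X)"
      using F(1) is_edge_cut_edge_boundary[OF G X] unfolding is_minimum_edge_cut_def by blast
    finally show ?thesis .
  next
    assume deg: "m \<le> min_degree G"
    have no_edge: "m \<le> card (edge_boundary G Y)"
      if Y: "Y \<noteq> {}" "Y \<subseteq> verts G" "\<not> (\<exists>e\<in>edges G. e \<subseteq> Y)" for Y
    proof -
      obtain y where y: "y \<in> Y" using Y(1) by blast
      have "m \<le> degree G y"
        using deg y Y(2) G unfolding min_degree_def simple_graph_def by (subst (asm) Min_ge_iff) auto
      also have "\<dots> \<le> card (edge_boundary G Y)"
        unfolding degree_def using y Y(3) finE by (intro card_mono) (auto simp: edge_boundary_def)
      finally show ?thesis .
    qed
    have E: "e \<subseteq> verts G" if "e \<in> edges G" for e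
      using G that by (simp add: simple_graph_def)
    have compl: "edge_boundary G (verts G - X) = edge_boundary G X"
      using E X(2) unfolding edge_boundary_def by blast
    show ?thesis
    proof (cases "(\<exists>e\<in>edges G. e \<subseteq> X) \<and> (\<exists>f\<in>edges G. f \<subseteq> verts G - X)")
      case True
      then obtain e f where "e \<in> edges G" "e \<subseteq> X" "f \<in> edges G" "f \<inter> X = {}" by blast
      then show ?thesis by (rule k_connected_line_graph_edge_boundary[OF G L])
    next
      case False
      then show ?thesis using no_edge[of X] no_edge[of "verts G - X"] X compl by auto
    qed
  }
qed

section \<open>Completely independent spanning trees\<close>

text \<open>A variant of Araki's criterion. The colour classes of \<open>c\<close> are the sets of inner vertices of the
  trees, and every vertex \<open>v\<close> of another colour hangs off \<open>\<phi> i v\<close> as a leaf of tree \<open>i\<close>. The last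
  assumption says that no edge is chosen from both of its ends.\<close>
theorem completely_independent_spanning_trees_colouring:
  fixes c :: "'v \<Rightarrow> nat"
  assumes H: "simple_graph H"
    and root: "\<And>i. i < k \<Longrightarrow> r i \<in> verts H \<and> c (r i) = i"
    and connected: "\<And>i v. i < k \<Longrightarrow> v \<in> verts H \<Longrightarrow> c v = i \<Longrightarrow>
      (r i, v) \<in> conn {e \<in> edges H. \<forall>x\<in>e. c x = i}"
    and leaf: "\<And>i v. i < k \<Longrightarrow> v \<in> verts H \<Longrightarrow> c v \<noteq> i \<Longrightarrow>
      \<phi> i v \<in> verts H \<and> c (\<phi> i v) = i \<and> {v, \<phi> i v} \<in> edges H"
    and oriented: "\<And>i v. i < k \<Longrightarrow> v \<in> verts H \<Longrightarrow> c v < k \<Longrightarrow> c v \<noteq> i \<Longrightarrow> \<phi> (c v) (\<phi> i v) \<noteq> v"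
  shows "\<exists>T. completely_independent_spanning_trees H k T"
proof -
  have finV: "finite (verts H)" using H by (simp add: simple_graph_def)
  define F where "F i = {e \<in> edges H. \<forall>x\<in>e. c x = i}" for i
  have "\<exists>(d :: 'v \<Rightarrow> nat) \<pi>. \<forall>v. (r i, v) \<in> conn (F i) \<longrightarrow> v \<noteq> r i \<longrightarrow>
      {v, \<pi> v} \<in> F i \<and> d (\<pi> v) < d v" for i
    by (rule rooted_parents[of "r i" "F i"]) blast
  then obtain d :: "nat \<Rightarrow> 'v \<Rightarrow> nat" and \<pi> where
    \<pi>: "\<And>i v. (r i, v) \<in> conn (F i) \<Longrightarrow> v \<noteq> r i \<Longrightarrow> {v, \<pi> i v} \<in> F i \<and> d i (\<pi> i v) < d i v"
    by metis
  define par where "par i v = (if c v = i then \<pi> i v else \<phi> i v)" for i v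
  \<comment> \<open>Leaves are placed above all vertices of colour \<open>i\<close>, so parents
    decrease \<open>D i\<close> throughout the tree.\<close>
  define D where "D i v = (if c v = i then d i v else Suc (Max (d i ` verts H)))" for i v
  define T where "T i = \<lparr>verts = verts H, edges = (\<lambda>v. {v, par i v}) ` (verts H - {r i})\<rparr>" for i
  have par: "par i v \<in> verts H \<and> c (par i v) = i \<and> {v, par i v} \<in> edges H \<and> D i (par i v) < D i v"
    if i: "i < k" and v: "v \<in> verts H - {r i}" for i v
  proof (cases "c v = i")
    case True
    then have "{v, \<pi> i v} \<in> F i \<and> d i (\<pi> i v) < d i v"
      using \<pi>[of i v] connected[OF i _ True] v unfolding F_def by blast
    moreover from this have "\<pi> i v \<in> verts H" using H by (auto simp: simple_graph_def F_def)
    ultimately show ?thesis using True by (auto simp: par_def D_def F_def)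
  next
    case False
    then have "\<phi> i v \<in> verts H \<and> c (\<phi> i v) = i \<and> {v, \<phi> i v} \<in> edges H"
      using leaf[OF i] v by blast
    moreover from this have "d i (\<phi> i v) \<le> Max (d i ` verts H)" using finV by simp
    ultimately show ?thesis using False by (auto simp: par_def D_def)
  qed
  have tree: "spanning_tree H (T i)" if i: "i < k" for i
  proof -
    have "is_tree (T i)"
      unfolding T_def using par[OF i] root[OF i] finV by (intro is_tree_parent[where d = "D i"]) auto
    then show ?thesis using par[OF i] by (auto simp: spanning_tree_def T_def)
  qed
  \<comment> \<open>Every edge of \<open>T i\<close> has a parent end of colour \<open>i\<close>. A
    common edge would thus have ends of colours \<open>i\<close> and \<open>j\<close>, each the
    chosen parent of the other.\<close>
  have disjoint: "edges (T i) \<inter> edges (T j) = {}" if ij: "i < k" "j < k" "i \<noteq> j" for i j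
  proof (rule ccontr)
    assume "edges (T i) \<inter> edges (T j) \<noteq> {}"
    then obtain v w where v: "v \<in> verts H - {r i}" and w: "w \<in> verts H - {r j}"
      and eq: "{v, par i v} = {w, par j w}"
      by (auto simp: T_def)
    have cv: "c (par i v) = i" and cw: "c (par j w) = j"
      using par[OF ij(1) v] par[OF ij(2) w] by auto
    then have "v = par j w" "w = par i v"
      using eq ij(3) by (auto simp: doubleton_eq_iff)
    then have "c v = j" "w = \<phi> i v" "v = \<phi> j w"
      using cv cw ij(3) by (auto simp: par_def split: if_splits)
    then have "\<phi> (c v) (\<phi> i v) = v" by metis
    then show False using oriented[of i v] v ij \<open>c v = j\<close> by simp
  qed
  \<comment> \<open>A vertex of another colour has its parent as only neighbour in
    \<open>T i\<close>, hence is never interior to a path.\<close>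
  have inner: "c x = i" if i: "i < k" and p: "is_path (T i) u p v" and x: "x \<in> set p" "x \<noteq> u" "x \<noteq> v"
    for i u v p x
  proof (rule ccontr)
    assume cx: "c x \<noteq> i"
    have "distinct p" "x \<noteq> hd p" "x \<noteq> last p" and sub: "walk_edges p \<subseteq> edges (T i)"
      using p x by (auto simp: is_path_def is_walk_def)
    then obtain a b where ab: "a \<noteq> b" "{a, x} \<in> walk_edges p" "{x, b} \<in> walk_edges p"
      using x(1) walk_interior_neighbours by metis
    have "y = par i x" if yx: "{y, x} \<in> edges (T i)" for y
    proof -
      obtain z where z: "z \<in> verts H - {r i}" "{y, x} = {z, par i z}"
        using yx by (auto simp: T_def)
      then show ?thesis using par[OF i z(1)] cx by (auto simp: doubleton_eq_iff)
    qed
    then show False using ab sub by (metis insert_commute subsetD)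
  qed
  have "completely_independent_spanning_trees H k T"
    unfolding completely_independent_spanning_trees_def
  proof (intro conjI ballI allI impI)
    fix u v i j p q
    assume ij: "i < k" "j < k" "i \<noteq> j" and pq: "is_path (T i) u p v \<and> is_path (T j) u q v"
    show "walk_edges p \<inter> walk_edges q = {}"
      using pq disjoint[OF ij] unfolding is_path_def is_walk_def by blast
    show "set p \<inter> set q \<subseteq> {u, v}"
      using inner[of i u p v] inner[of j u q v] ij pq by blast
  qed (use tree in auto)
  then show ?thesis by blast
qed

lemma line_graph_conn:
  assumes "(u, w) \<in> conn T" "u \<in> e" "e \<in> W" "w \<in> f" "f \<in> W" "T \<subseteq> W"
  shows "(e, f) \<in> conn {{g, h} | g h. g \<in> W \<and> h \<in> W \<and> g \<noteq> h \<and> g \<inter> h \<noteq> {}}" (is "_ \<in> conn ?L")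
proof -
  have adjacent: "(g, h) \<in> conn ?L" if "x \<in> g" "x \<in> h" "g \<in> W" "h \<in> W" for x g h
  proof (cases "g = h")
    case False
    then have "{g, h} \<in> ?L" using that by blast
    then show ?thesis by (rule conn_edge)
  qed simp
  \<comment> \<open>The claim is strengthened to all edges of \<open>W\<close> at the current
    vertex, so that the next edge of the walk is among them.\<close>
  have "\<forall>f\<in>W. w \<in> f \<longrightarrow> (e, f) \<in> conn ?L"
    using assms(1)
  proof (induction rule: conn_induct)
    case refl
    show ?case using adjacent assms(2,3) by blast
  next
    case (step y z)
    have yz: "{y, z} \<in> W" using step(2) assms(6) by blast
    then have "(e, {y, z}) \<in> conn ?L" using step(3) by blast
    then show ?case using adjacent[of z "{y, z}"] yz conn_trans by fastforce
  qed
  then show ?thesis using assms(4,5) by blast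
qed

text \<open>Each \<open>p i\<close> assigns to a vertex other than the root \<open>r\<close> its parent edge in the \<open>i\<close>-th tree. An
  edge \<open>e\<close> hangs off \<open>p j (a e)\<close> in the \<open>j\<close>-th tree, where the end \<open>a e\<close> is the vertex owning \<open>e\<close> as
  parent edge only if the other end is \<open>r\<close>. Two edges choosing each other would then have the
  same ends.\<close>
theorem line_graph_completely_independent_spanning_trees:
  assumes G: "simple_graph G" and S: "edges G - S \<noteq> {}"
    and sub: "\<And>i. i < k \<Longrightarrow> I i \<subseteq> edges G - S"
    and spanning: "\<And>i. i < k \<Longrightarrow> verts G \<times> verts G \<subseteq> conn (I i)"
    and disj: "disjoint_family_on I {..<k}"
  shows "\<exists>T. completely_independent_spanning_trees (delete_verts (line_graph G) S) k T"
proof -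
  let ?H = "delete_verts (line_graph G) S"
  let ?E = "edges G - S"
  have E: "e \<subseteq> verts G" "card e = 2" if "e \<in> ?E" for e
    using G that by (auto simp: simple_graph_def)
  have HV: "verts ?H = ?E" by (simp add: delete_verts_def line_graph_def)
  have HE: "edges ?H = {{e, f} | e f. e \<in> ?E \<and> f \<in> ?E \<and> e \<noteq> f \<and> e \<inter> f \<noteq> {}}"
    by (auto simp: delete_verts_def line_graph_def)
  have "finite (edges G)"
    using G unfolding simple_graph_def by (meson PowI finite_Pow_iff finite_subset subsetI)
  then have H: "simple_graph ?H"
    unfolding simple_graph_def HV HE by (auto simp: card_2_iff)
  obtain e0 where "e0 \<in> ?E" using S by blast
  then obtain r s where rs: "r \<in> verts G" "s \<in> verts G" "r \<noteq> s"
    using E[of e0] by (auto simp: card_2_iff)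
  have "\<exists>p. inj_on p (verts G - {r}) \<and> (\<forall>v\<in>verts G - {r}. v \<in> p v \<and> p v \<in> I i)" if i: "i < k" for i
  proof -
    obtain d :: "_ \<Rightarrow> nat" and \<pi> where
      \<pi>: "\<And>v. (r, v) \<in> conn (I i) \<Longrightarrow> v \<noteq> r \<Longrightarrow> {v, \<pi> v} \<in> I i \<and> d (\<pi> v) < d v"
      by (rule rooted_parents[of r "I i"]) blast
    have \<pi>': "{v, \<pi> v} \<in> I i \<and> d (\<pi> v) < d v" if "v \<in> verts G - {r}" for v
      using \<pi>[of v] spanning[OF i] rs that by blast
    \<comment> \<open>Two vertices owning the same edge would be parents of each other, against the
      decrease of \<open>d\<close>.\<close>
    have "inj_on (\<lambda>v. {v, \<pi> v}) (verts G - {r})"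
    proof (rule inj_onI)
      fix x y assume "x \<in> verts G - {r}" "y \<in> verts G - {r}" "{x, \<pi> x} = {y, \<pi> y}"
      then show "x = y" using \<pi>'[of x] \<pi>'[of y] by (auto simp: doubleton_eq_iff)
    qed
    then show ?thesis using \<pi>' by (intro exI[of _ "\<lambda>v. {v, \<pi> v}"]) auto
  qed
  then obtain p where inj: "\<And>i. i < k \<Longrightarrow> inj_on (p i) (verts G - {r})"
    and p: "\<And>i v. i < k \<Longrightarrow> v \<in> verts G - {r} \<Longrightarrow> v \<in> p i v \<and> p i v \<in> I i"
    by metis
  \<comment> \<open>Disjointness makes the colour unique; edges in no \<open>I i\<close> get colour
    0.\<close>
  define c where "c e = (if \<exists>i<k. e \<in> I i then THE i. i < k \<and> e \<in> I i else 0)" for e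
  have cI: "c e = i" if i: "i < k" "e \<in> I i" for e i
  proof -
    have "(THE i. i < k \<and> e \<in> I i) = i"
      using i disj by (intro the_equality) (auto simp: disjoint_family_on_def)
    then show ?thesis using i by (auto simp: c_def)
  qed
  \<comment> \<open>If \<open>r\<close> is an end, the other end is taken. Otherwise injectivity
    lets at most one end own \<open>e\<close>, and an end not owning it is available.\<close>
  have "\<exists>x. x \<in> e \<and> x \<in> verts G - {r} \<and> (c e < k \<longrightarrow> e = p (c e) x \<longrightarrow> r \<in> e)" if e: "e \<in> ?E" for e
  proof -
    obtain u v where uv: "e = {u, v}" "u \<noteq> v" "u \<in> verts G" "v \<in> verts G"
      using E[OF e] by (auto simp: card_2_iff)
    show ?thesis
    proof (cases "r \<in> e")
      case False
      then have uv': "u \<in> verts G - {r}" "v \<in> verts G - {r}" using uv by auto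
      then have "\<not> (c e < k \<and> e = p (c e) u \<and> e = p (c e) v)"
        using inj_onD[OF inj] uv(2) by metis
      then show ?thesis using uv' uv(1) by blast
    qed (use uv in auto)
  qed
  then obtain a where a: "\<And>e. e \<in> ?E \<Longrightarrow> a e \<in> e \<and> a e \<in> verts G - {r}"
    and a_owner: "\<And>e. e \<in> ?E \<Longrightarrow> c e < k \<Longrightarrow> e = p (c e) (a e) \<Longrightarrow> r \<in> e"
    by metis
  have pair: "e = {x, y}" if "e \<in> ?E" "x \<in> e" "y \<in> e" "x \<noteq> y" for e x y
    using E(2)[OF that(1)] that by (auto simp: card_2_iff)
  have s: "s \<in> verts G - {r}" using rs by auto
  show ?thesis
  proof (rule completely_independent_spanning_trees_colouring[OF H, unfolded HV,
        where c = c and r = "\<lambda>i. p i s" and \<phi> = "\<lambda>i e. p i (a e)"])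
    show "p i s \<in> ?E \<and> c (p i s) = i" if "i < k" for i
      using p[OF that s] sub[OF that] cI[OF that] by blast
    show "(p i s, e) \<in> conn {g \<in> edges ?H. \<forall>x\<in>g. c x = i}" if i: "i < k" "e \<in> ?E" "c e = i" for i e
    proof -
      let ?W = "{e \<in> ?E. c e = i}"
      have "I i \<subseteq> ?W" using sub[OF i(1)] cI[OF i(1)] by blast
      moreover have "(s, a e) \<in> conn (I i)"
        using spanning[OF i(1)] a[OF i(2)] rs by blast
      ultimately have "(p i s, e) \<in> conn {{g, h} | g h. g \<in> ?W \<and> h \<in> ?W \<and> g \<noteq> h \<and> g \<inter> h \<noteq> {}}"
        using p[OF i(1) s] a[OF i(2)] i by (intro line_graph_conn) auto
      moreover have "{{g, h} | g h. g \<in> ?W \<and> h \<in> ?W \<and> g \<noteq> h \<and> g \<inter> h \<noteq> {}}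
          \<subseteq> {g \<in> edges ?H. \<forall>x\<in>g. c x = i}"
        unfolding HE by auto
      ultimately show ?thesis by (rule subsetD[OF conn_mono, rotated])
    qed
    show "p i (a e) \<in> ?E \<and> c (p i (a e)) = i \<and> {e, p i (a e)} \<in> edges ?H"
      if i: "i < k" "e \<in> ?E" "c e \<noteq> i" for i e
    proof -
      have f: "a e \<in> p i (a e)" "p i (a e) \<in> ?E" "c (p i (a e)) = i"
        using p[OF i(1)] a[OF i(2)] sub[OF i(1)] cI[OF i(1)] by blast+
      moreover have "e \<noteq> p i (a e)" using f(3) i(3) by metis
      ultimately show ?thesis unfolding HE using i(2) a[OF i(2)] by blast
    qed
    show "p (c e) (a (p i (a e))) \<noteq> e" if i: "i < k" "e \<in> ?E" "c e < k" "c e \<noteq> i" for i e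
    proof
      assume mutual: "p (c e) (a (p i (a e))) = e"
      define f where "f = p i (a e)"
      have f: "a e \<in> f" "f \<in> ?E" "c f = i"
        using p[OF i(1)] a[OF i(2)] sub[OF i(1)] cI[OF i(1)] unfolding f_def by blast+
      have af: "a f \<in> e" using p[OF i(3)] a[OF f(2)] mutual unfolding f_def by metis
      \<comment> \<open>Both edges contain \<open>a e\<close> and \<open>a f\<close>. If these
        coincide, that vertex owns both edges, so both also contain \<open>r\<close>; in either case
        the edges share two distinct ends.\<close>
      have "e = f"
      proof (cases "a e = a f")
        case True
        then have "r \<in> e" "r \<in> f"
          using a_owner[OF i(2,3)] a_owner[OF f(2)] mutual i(1) f(3) unfolding f_def by auto
        then show ?thesis
          using pair[OF i(2), of "a e" r] pair[OF f(2), of "a e" r] a[OF i(2)] f(1) by auto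
      next
        case False
        then show ?thesis
          using pair[OF i(2), of "a e" "a f"] pair[OF f(2), of "a e" "a f"] a[OF i(2)] a[OF f(2)] af f(1)
          by auto
      qed
      then show False using f(3) i(4) by simp
    qed
  qed
qed

theorem theorem11:
  fixes k :: nat and G :: "'a ugraph" and S :: "'a set set"
  assumes "k > 0"
    and "simple_graph G"
    and "k_connected (2 * k) (line_graph G)"
    and "S \<subset> verts (line_graph G)"
    and "card S \<le> k"
    and "(graph_connected G \<and> \<not> super_edge_connected G) \<or> min_degree G \<ge> 2 * k"
  shows "\<exists>T. completely_independent_spanning_trees (delete_verts (line_graph G) S) k T"
proof -
  have S: "S \<subset> edges G" using assms(4) by (simp add: line_graph_def)
  have E: "\<And>e. e \<in> edges G - S \<Longrightarrow> e \<subseteq> verts G \<and> card e = 2" and finV: "finite (verts G)"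
    using assms(2) by (auto simp: simple_graph_def)
  obtain e where e: "e \<in> edges G - S" using S by blast
  have V: "verts G \<noteq> {}" using E[OF e] by auto
  have cut: "2 * k \<le> card (edge_boundary G X)" if "X \<noteq> {}" "X \<subset> verts G" for X
    using edge_boundary_ge_connectivity_line_graph[OF assms(2,3,6)] that by blast
  have cross: "k * (card P - 1) \<le> card {e \<in> edges G - S. \<forall>X\<in>P. \<not> e \<subseteq> X}"
    if "partition_on (verts G) P" for P
    using crossing_edges_ge[OF assms(2) cut _ assms(5) that] S by blast
  obtain I where I: "\<forall>i<k. I i \<subseteq> edges G - S \<and> verts G \<times> verts G \<subseteq> conn (I i)"
    "disjoint_family_on I {..<k}"
    by (rule tree_packing[OF finV V E cross])
  show ?thesis
    by (rule line_graph_completely_independent_spanning_trees[OF assms(2) _ _ _ I(2)]) (use e I in auto)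
qed

end
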